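(* Consider the problem of minimizing $F=(F_1,\dots,F_m)^\top$ over $\mathbf{R}^n$ (setting in the context), let $X^*$ be its set of weakly Pareto optimal points, and assume that $X^*$ is nonempty. Let $x^0\in\operatorname{dom}F$ and $\Omega_F(F(x^0))=\{x\in\mathbf{R}^n : F(x)\le F(x^0)\}$. Assume that for all $x\in\Omega_F(F(x^0))$ there exists $x^*\in X^*$ such that $F(x^* )\le F(x)$, and that $$R:=\sup_{F^*\in F(X^*\cap\Omega_F(F(x^0)))}\ \min_{x\in F^{-1}(\{F^*\})}\|x-x^0\|^2<\infty .$$ Let $\{x^k\}$ be a sequence generated by the multiobjective MFISTA algorithm (described in the context) with initial point $x^0$ and parameter $\ell\ge L$. Then, for all $k\ge0$, $$u_0(x^k)\le\frac{2\ell R}{(k+1)^2},$$ where $u_0(x)=\sup_{z\in\mathbf{R}^n}\min_{i\in\{1,\ldots,m\}}\big(F_i(x)-F_i(z)\big)$.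
   Context: Problem setting: $F=(F_1,\dots,F_m)^\top$ with $F_i(x)=f_i(x)+g_i(x)$, $i=1,\dots,m$, where $f_i:\mathbf{R}^n\to\mathbf{R}$ is convex and continuously differentiable with Lipschitz continuous gradient of constant $L_i>0$, and $g_i:\mathbf{R}^n\to(-\infty,\infty]$ is closed, proper and convex. Put $L=\max_{i\in\{1,\dots,m\}}L_i$ and $\operatorname{dom}F=\{x\in\mathbf{R}^n : F(x)<\infty\}$ (that is, $F_i(x)<\infty$ for all $i$). $\|\cdot\|$ and $\langle\cdot,\cdot\rangle$ are the Euclidean norm and inner product. Vector inequalities $\le$ and $<$ are componentwise. A point $x^*$ is weakly Pareto optimal if there is no $x\in\mathbf{R}^n$ with $F(x)<F(x^* )$. Subproblem solution: for $\ell\ge L$ and given $x,y\in\mathbf{R}^n$, $d_\ell(x,y)$ denotes the unique minimizer $$d_\ell(x,y)=\operatorname*{argmin}_{z\in\mathbf{R}^n}\ \max_{i\in\{1,\ldots,m\}}\Big(\langle\nabla f_i(y),z-y\rangle+g_i(z)+f_i(y)-F_i(x)\Big)+\frac{\ell}{2}\|z-y\|^2 .$$ Multiobjective MFISTA: set $y^1=x^0\in\operatorname{dom}F$, $t_1=1$, $\ell\ge L$, $\varepsilon>0$, $k=1$. While $\|d_\ell(x^{k-1},y^k)-y^k\|\ge\varepsilon$, do: (i) $z^k=d_\ell(x^{k-1},y^k)$; (ii) if $\max_{i\in\{1,\dots,m\}}\big(F_i(x^{k-1})-F_i(z^k)\big)\ge 0$ then $x^k=z^k$, otherwise $x^k=x^{k-1}$;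 (iii) $t_{k+1}=\big(1+\sqrt{1+4t_k^2}\big)/2$; (iv) $y^{k+1}=x^k+\frac{t_k}{t_{k+1}}(z^k-x^k)+\frac{t_k-1}{t_{k+1}}(x^k-x^{k-1})$; (v) replace $k$ by $k+1$.
   Formalization: The bound is proved for all generated iterates with k ≥ 1 instead of k ≥ 0; at k = 0 it is false in general (m = n = 1, f = 0, g(x) = 1000|x|, x^0 = 1, ℓ = L = 1 gives u_0(x^0) = 1000 > 2 = 2ℓR). *)

theory Defs
  imports "HOL-Analysis.Analysis"
begin

text \<open>A vector-valued function with \<open>m\<close> components is a function into \<open>'m \<Rightarrow> ereal\<close> with
  \<open>'m\<close> finite (and, like every type, nonempty). The order \<open>\<le>\<close> on \<open>'m \<Rightarrow> ereal\<close> is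
  componentwise, but \<open><\<close> is not the componentwise strict order, so the latter is written out.\<close>

subsection \<open>Extended-valued convex functions\<close>

definition epigraph_ereal :: "('a \<Rightarrow> ereal) \<Rightarrow> ('a \<times> real) set" where
  "epigraph_ereal g = {(x, a). g x \<le> ereal a}"

definition closed_proper_convex :: "('a::real_normed_vector \<Rightarrow> ereal) \<Rightarrow> bool" where
  "closed_proper_convex g \<longleftrightarrow>
     closed (epigraph_ereal g) \<and>
     (\<forall>x. g x \<noteq> -\<infinity>) \<and> (\<exists>x. g x < \<infinity>) \<and>
     convex (epigraph_ereal g)"

subsection \<open>Multiobjective problems\<close>

definition objective ::
    "('m \<Rightarrow> 'a \<Rightarrow> real) \<Rightarrow> ('m \<Rightarrow> 'a \<Rightarrow> ereal) \<Rightarrow> 'a \<Rightarrow> 'm \<Rightarrow> ereal" where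
  "objective f g x i = ereal (f i x) + g i x"

definition effective_domain :: "('a \<Rightarrow> 'm \<Rightarrow> ereal) \<Rightarrow> 'a set" where
  "effective_domain F = {x. \<forall>i. F x i < \<infinity>}"

definition weakly_pareto :: "('a \<Rightarrow> 'm \<Rightarrow> ereal) \<Rightarrow> 'a set" where
  "weakly_pareto F = {xs. \<not> (\<exists>x. \<forall>i. F x i < F xs i)}"

definition sublevel :: "('a \<Rightarrow> 'm \<Rightarrow> ereal) \<Rightarrow> ('m \<Rightarrow> ereal) \<Rightarrow> 'a set" where
  "sublevel F c = {x. F x \<le> c}"

text \<open>In \<open>ereal\<close>, \<open>\<infinity> - \<infinity> = \<infinity>\<close>; the differences below are only meaningful when the
  minuend is finite, i.e. for \<open>x\<close> in the effective domain.\<close>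

definition merit :: "('a \<Rightarrow> 'm::finite \<Rightarrow> ereal) \<Rightarrow> 'a \<Rightarrow> ereal" where
  "merit F x = (SUP z. MIN i. F x i - F z i)"

text \<open>The inner infimum is the minimum of the squared distance whenever that minimum is attained.\<close>

definition radius :: "('a::real_normed_vector \<Rightarrow> 'm \<Rightarrow> ereal) \<Rightarrow> 'a \<Rightarrow> ereal" where
  "radius F x0 =
     (SUP c \<in> F ` (weakly_pareto F \<inter> sublevel F (F x0)).
        INF x \<in> F -` {c}. ereal ((norm (x - x0))\<^sup>2))"

subsection \<open>The multiobjective MFISTA algorithm\<close>

text \<open>Throughout, \<open>gradf i\<close> is the gradient of \<open>f i\<close>.\<close>

definition subproblem_objective ::
    "('m::finite \<Rightarrow> 'a::real_inner \<Rightarrow> real) \<Rightarrow> ('m \<Rightarrow> 'a \<Rightarrow> 'a) \<Rightarrow> ('m \<Rightarrow> 'a \<Rightarrow> ereal)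
      \<Rightarrow> real \<Rightarrow> 'a \<Rightarrow> 'a \<Rightarrow> 'a \<Rightarrow> ereal" where
  "subproblem_objective f gradf g l x y z =
     (MAX i. ereal (gradf i y \<bullet> (z - y)) + g i z + ereal (f i y) - objective f g x i)
     + ereal (l / 2 * (norm (z - y))\<^sup>2)"

definition subproblem_solution ::
    "('m::finite \<Rightarrow> 'a::real_inner \<Rightarrow> real) \<Rightarrow> ('m \<Rightarrow> 'a \<Rightarrow> 'a) \<Rightarrow> ('m \<Rightarrow> 'a \<Rightarrow> ereal)
      \<Rightarrow> real \<Rightarrow> 'a \<Rightarrow> 'a \<Rightarrow> 'a" where
  "subproblem_solution f gradf g l x y =
     (ARG_MIN (subproblem_objective f gradf g l x y) z. True)"

text \<open>The number of executed passes through the loop is \<open>N\<close>, with \<open>N = \<infinity>\<close> if the stopping test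
  never succeeds. Pass \<open>k\<close> (\<open>1 \<le> k \<le> N\<close>) computes \<open>z k\<close>, \<open>x k\<close>, \<open>t (k + 1)\<close> and
  \<open>y (k + 1)\<close>. Hence \<open>x k\<close> is an iterate of the algorithm precisely for \<open>k \<le> N\<close>, and the
  values at other indices (and at index \<open>0\<close> of \<open>y\<close>, \<open>z\<close>, \<open>t\<close>) are irrelevant.\<close>

definition mfista_run ::
    "('m::finite \<Rightarrow> 'a::real_inner \<Rightarrow> real) \<Rightarrow> ('m \<Rightarrow> 'a \<Rightarrow> 'a) \<Rightarrow> ('m \<Rightarrow> 'a \<Rightarrow> ereal)
      \<Rightarrow> real \<Rightarrow> real \<Rightarrow> 'a \<Rightarrow> enat
      \<Rightarrow> (nat \<Rightarrow> 'a) \<Rightarrow> (nat \<Rightarrow> 'a) \<Rightarrow> (nat \<Rightarrow> 'a) \<Rightarrow> (nat \<Rightarrow> real) \<Rightarrow> bool" where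
  "mfista_run f gradf g l \<epsilon> x0 N x y z t \<longleftrightarrow>
     (let F = objective f g; d = subproblem_solution f gradf g l in
      x 0 = x0 \<and> y 1 = x0 \<and> t 1 = 1 \<and>
      (\<forall>k\<ge>1. enat k \<le> N \<longrightarrow>
         norm (d (x (k - 1)) (y k) - y k) \<ge> \<epsilon> \<and>
         z k = d (x (k - 1)) (y k) \<and>
         x k = (if (MAX i. F (x (k - 1)) i - F (z k) i) \<ge> 0 then z k else x (k - 1)) \<and>
         t (k + 1) = (1 + sqrt (1 + 4 * (t k)\<^sup>2)) / 2 \<and>
         y (k + 1) = x k + (t k / t (k + 1)) *\<^sub>R (z k - x k)
                         + ((t k - 1) / t (k + 1)) *\<^sub>R (x k - x (k - 1))) \<and>
      (\<forall>k\<ge>1. N = enat (k - 1) \<longrightarrow> norm (d (x (k - 1)) (y k) - y k) < \<epsilon>))"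

text \<open>The \<open>O(1/k\<^sup>2)\<close> bound on \<open>merit F (x k)\<close> concerns the iterates computed by the algorithm,
  \<open>k \<ge> 1\<close>. Extended to the freely chosen starting point, \<open>k = 0\<close>, it would read
  \<open>merit F x0 \<le> 2 * l * radius F x0\<close>, which is false in general: for \<open>m = n = 1\<close>, \<open>f = 0\<close>,
  \<open>g x = 1000 * \<bar>x\<bar>\<close>, \<open>x0 = 1\<close>, \<open>l = 1\<close> the left-hand side is \<open>1000\<close> and the right-hand side
  is only \<open>2\<close>.\<close>

end

theory Submission
  imports Defs
begin

text \<open>Comparing the minimizer \<open>z\<^sup>k\<close> of the strongly convex subproblem with \<open>x\<^sup>k\<^sup>-\<^sup>1\<close> gives
  \<open>F\<^sub>i (x\<^sup>k) + l/2 \<parallel>x\<^sup>k - y\<^sup>k\<^sup>+\<^sup>1\<parallel>\<^sup>2 \<le> F\<^sub>i (x\<^sup>0)\<close>, hence the iterates stay in the initial sublevel set.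
  Comparing it with \<open>(1 - 1/t\<^sub>k) x\<^sup>k\<^sup>-\<^sup>1 + w/t\<^sub>k\<close> shows that
  \<open>t\<^sub>k\<^sup>2 min\<^sub>i (F\<^sub>i (x\<^sup>k) - F\<^sub>i w) + l/2 \<parallel>t\<^sub>k z\<^sup>k - (t\<^sub>k - 1) x\<^sup>k\<^sup>-\<^sup>1 - w\<parallel>\<^sup>2\<close> does not increase,
  and \<open>t\<^sub>k \<ge> (k + 1)/2\<close>. A point with positive gap lies in the initial sublevel set, so it is dominated
  by a weakly Pareto optimal point, and any point with the same objective values may be used as \<open>w\<close>.
  A rejected \<open>z\<^sup>k\<close> is worse than \<open>x\<^sup>k\<^sup>-\<^sup>1\<close> in every component, so both estimates survive rejection.\<close>

section \<open>Convex functions with Lipschitz gradient\<close>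

lemma has_real_derivative_along_line:
  fixes f :: "'a::real_inner \<Rightarrow> real"
  assumes "\<And>w. GDERIV f w :> df w"
  shows "((\<lambda>s. f (a + s *\<^sub>R v)) has_real_derivative (df (a + s *\<^sub>R v) \<bullet> v)) (at s)"
proof -
  have "(f has_derivative (\<lambda>h. h \<bullet> df (a + s *\<^sub>R v))) (at (a + s *\<^sub>R v))"
    using assms by (simp add: gderiv_def)
  then have "((\<lambda>s. f (a + s *\<^sub>R v)) has_derivative (\<lambda>h. (h *\<^sub>R v) \<bullet> df (a + s *\<^sub>R v))) (at s)"
    by (rule has_derivative_compose[rotated]) (auto intro!: derivative_eq_intros)
  then show ?thesis
    by (simp add: has_field_derivative_def inner_commute mult.commute[of "v \<bullet> _"]
        mult_commute_abs)
qed

text \<open>Restricting \<open>f\<close> to the line through \<open>y\<close> and \<open>w\<close>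
  leaves the tangent inequality for a convex function of one real variable, compared at parameters 0
  and 1.\<close>

lemma convex_on_above_gradient:
  fixes f :: "'a::real_inner \<Rightarrow> real"
  assumes convex: "convex_on UNIV f" and gderiv: "\<And>w. GDERIV f w :> df w"
  shows "f y + df y \<bullet> (w - y) \<le> f w"
proof -
  define h where "h s = f (y + s *\<^sub>R (w - y))" for s :: real
  have "convex_on UNIV h"
  proof (rule convex_onI)
    fix t a b :: real
    assume t: "0 < t" "t < 1"
    have "y + ((1 - t) *\<^sub>R a + t *\<^sub>R b) *\<^sub>R (w - y)
        = (1 - t) *\<^sub>R (y + a *\<^sub>R (w - y)) + t *\<^sub>R (y + b *\<^sub>R (w - y))"
      by (simp add: algebra_simps)
    then show "h ((1 - t) *\<^sub>R a + t *\<^sub>R b) \<le> (1 - t) * h a + t * h b"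
      unfolding h_def using convex_onD[OF convex, of t] t by simp
  qed simp
  moreover have "(h has_real_derivative (df y \<bullet> (w - y))) (at 0)"
    using has_real_derivative_along_line[OF gderiv, of y "w - y" 0] by (simp add: h_def[abs_def])
  ultimately have "h 1 - h 0 \<ge> (df y \<bullet> (w - y)) * (1 - 0)"
    by (intro convex_on_imp_above_tangent[of UNIV]) auto
  then show ?thesis by (simp add: h_def)
qed

text \<open>No integration of the gradient: \<open>f\<close> minus its quadratic model along the
  segment is nonincreasing on [0, 1], because Cauchy-Schwarz and the Lipschitz bound make its
  derivative nonpositive.\<close>

lemma descent_lemma:
  fixes f :: "'a::real_inner \<Rightarrow> real"
  assumes lipschitz: "L-lipschitz_on UNIV df" and gderiv: "\<And>w. GDERIV f w :> df w"
  shows "f w \<le> f y + df y \<bullet> (w - y) + L / 2 * (norm (w - y))\<^sup>2"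
proof -
  define v where "v = w - y"
  define h where "h s = f (y + s *\<^sub>R v) - s * (df y \<bullet> v) - L / 2 * s\<^sup>2 * (norm v)\<^sup>2" for s
  have "h 1 \<le> h 0"
  proof (rule DERIV_nonpos_imp_nonincreasing[of 0 1 h])
    fix s :: real
    assume s: "0 \<le> s" "s \<le> 1"
    let ?D = "df (y + s *\<^sub>R v) \<bullet> v - df y \<bullet> v - L * s * (norm v)\<^sup>2"
    have "(h has_real_derivative ?D) (at s)"
      unfolding h_def[abs_def]
      by (rule derivative_eq_intros has_real_derivative_along_line gderiv refl)+ auto
    moreover have "?D \<le> 0"
    proof -
      have "(df (y + s *\<^sub>R v) - df y) \<bullet> v \<le> norm (df (y + s *\<^sub>R v) - df y) * norm v"
        by (rule norm_cauchy_schwarz)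
      also have "norm (df (y + s *\<^sub>R v) - df y) \<le> L * (s * norm v)"
        using lipschitz_onD[OF lipschitz, of "y + s *\<^sub>R v" y] s by (simp add: dist_norm)
      then have "norm (df (y + s *\<^sub>R v) - df y) * norm v \<le> L * (s * norm v) * norm v"
        by (rule mult_right_mono) simp
      finally show ?thesis by (simp add: inner_diff_left power2_eq_square)
    qed
    ultimately show "\<exists>D. (h has_real_derivative D) (at s) \<and> D \<le> 0" by blast
  qed simp
  then show ?thesis by (simp add: h_def v_def)
qed

section \<open>Proximal steps\<close>

text \<open>A proper closed convex function is represented by its epigraph \<open>E\<close>, so that neither maxima of
  functions nor infinite values occur.\<close>

lemma prox_exists:
  fixes E :: "('a::euclidean_space \<times> real) set"
  assumes closed: "closed E" and convex: "convex E" and l: "l > 0"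
    and above: "(u, b) \<in> E" and below: "(u, b') \<notin> E" and less: "b' < b"
  obtains d e where "(d, e) \<in> E"
    and "\<And>v c. (v, c) \<in> E \<Longrightarrow> e + l / 2 * (norm (d - y))\<^sup>2 \<le> c + l / 2 * (norm (v - y))\<^sup>2"
proof -
  \<comment> \<open>Separating the point below the epigraph from \<open>E\<close> yields an affine
    minorant. The hyperplane is not vertical, since \<open>(u, b)\<close> lies in \<open>E\<close>
    straight above the separated point; hence \<open>\<beta> > 0\<close>.\<close>
  obtain n \<gamma> where n: "n \<bullet> (u, b') < \<gamma>" "\<And>p. p \<in> E \<Longrightarrow> n \<bullet> p > \<gamma>"
    using separating_hyperplane_closed_point[OF convex closed below] by blast
  obtain a \<beta> where n_eq: "n = (a, \<beta>)" by (cases n)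
  have "\<beta> * (b - b') > 0" using n(1) n(2)[OF above] by (simp add: n_eq algebra_simps)
  then have \<beta>: "\<beta> > 0" using less by (simp add: zero_less_mult_iff)
  define p where "p = - (a /\<^sub>R \<beta>)"
  define \<alpha> where "\<alpha> = (\<gamma> - a \<bullet> y) / \<beta>"
  have minorant: "\<alpha> + p \<bullet> (v - y) \<le> c" if "(v, c) \<in> E" for v c
    using n(2)[OF that] \<beta> by (simp add: n_eq p_def \<alpha>_def field_simps inner_diff_right)
  define \<phi> where "\<phi> = (\<lambda>(v, c). c + l / 2 * (norm (v - y))\<^sup>2)"
  define S where "S = {q \<in> E. \<phi> q \<le> \<phi> (u, b)}"
  \<comment> \<open>Beyond distance 1 from \<open>y\<close> the quadratic term outgrows the affine
    minorant, which forces \<open>norm (v - y) \<le> 2 * K / l\<close> on \<open>S\<close>; the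
    summand 1 in \<open>r\<close> covers the points within distance 1.\<close>
  define K where "K = norm p + \<bar>\<phi> (u, b) - \<alpha>\<bar>"
  define r where "r = 1 + 2 / l * K"
  have K: "K \<ge> 0" by (simp add: K_def)
  have cont: "continuous_on A \<phi>" for A
    unfolding \<phi>_def case_prod_unfold by (intro continuous_intros)
  have "S \<subseteq> cball y r \<times> {\<alpha> - norm p * r .. \<phi> (u, b)}"
  proof safe
    fix v c
    assume "(v, c) \<in> S"
    then have E: "(v, c) \<in> E" and le: "c + l / 2 * (norm (v - y))\<^sup>2 \<le> \<phi> (u, b)"
      by (auto simp: S_def \<phi>_def)
    have lower: "\<alpha> - norm p * norm (v - y) \<le> c"
      using minorant[OF E] Cauchy_Schwarz_ineq2[of p "v - y"] by linarith
    have r: "norm (v - y) \<le> r"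
    proof (cases "norm (v - y) \<le> 1")
      case True
      then show ?thesis using K l by (simp add: r_def add_increasing2)
    next
      case False
      have "l / 2 * (norm (v - y))\<^sup>2 \<le> norm p * norm (v - y) + \<bar>\<phi> (u, b) - \<alpha>\<bar> * 1"
        using lower le abs_ge_self[of "\<phi> (u, b) - \<alpha>"] unfolding mult_1_right by linarith
      also have "\<dots> \<le> norm p * norm (v - y) + \<bar>\<phi> (u, b) - \<alpha>\<bar> * norm (v - y)"
        using False by (intro add_left_mono mult_left_mono) auto
      finally have "(l / 2 * norm (v - y)) * norm (v - y) \<le> K * norm (v - y)"
        by (simp add: K_def algebra_simps power2_eq_square)
      then have "l / 2 * norm (v - y) \<le> K" by (rule mult_right_le_imp_le) (use False in linarith)
      then show ?thesis using l by (simp add: r_def field_simps)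
    qed
    then show "v \<in> cball y r" by (simp add: dist_norm norm_minus_commute)
    have "norm p * norm (v - y) \<le> norm p * r" using r by (rule mult_left_mono) simp
    moreover have "0 \<le> l / 2 * (norm (v - y))\<^sup>2" using l by simp
    ultimately show "c \<in> {\<alpha> - norm p * r .. \<phi> (u, b)}" using lower le by simp
  qed
  then have "bounded S" by (rule bounded_subset[rotated]) (intro bounded_Times; simp)
  moreover have "closed S"
    unfolding S_def by (rule continuous_on_closed_Collect_le[OF _ _ closed]) (auto intro: cont)
  ultimately have "compact S" by (simp add: compact_eq_bounded_closed)
  moreover have u: "(u, b) \<in> S" using above by (simp add: S_def)
  ultimately obtain q where q: "q \<in> S" "\<And>q'. q' \<in> S \<Longrightarrow> \<phi> q \<le> \<phi> q'"
    using continuous_attains_inf[of S \<phi>] cont by blast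
  have "\<phi> q \<le> \<phi> q'" if "q' \<in> E" for q'
    using q(2)[of q'] q(2)[OF u] that by (cases "q' \<in> S") (auto simp: S_def)
  then show thesis using q(1) that[of "fst q" "snd q"] by (auto simp: S_def \<phi>_def case_prod_unfold)
qed

text \<open>Minimality is applied at points of the segment from \<open>d\<close> to \<open>w\<close>
  with parameter \<open>s\<close>. The identity for the squared norm of a convex combination
  produces the extra quadratic term; dividing by \<open>s\<close> and letting \<open>s\<close> tend
  to 0 gives its full weight.\<close>

lemma prox_strong_minimality:
  fixes E :: "('a::real_inner \<times> real) set"
  assumes convex: "convex E" and d: "(d, e) \<in> E" and w: "(w, c) \<in> E"
    and min: "\<And>v c. (v, c) \<in> E \<Longrightarrow> e + l / 2 * (norm (d - y))\<^sup>2 \<le> c + l / 2 * (norm (v - y))\<^sup>2"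
  shows "e + l / 2 * (norm (d - y))\<^sup>2 + l / 2 * (norm (w - d))\<^sup>2 \<le> c + l / 2 * (norm (w - y))\<^sup>2"
proof -
  let ?q = "\<lambda>v. l / 2 * (norm (v - y))\<^sup>2"
  have ineq: "e + ?q d + (1 - s) * (l / 2 * (norm (w - d))\<^sup>2) \<le> c + ?q w" if s: "0 < s" "s < 1" for s
  proof -
    define v where "v = (1 - s) *\<^sub>R d + s *\<^sub>R w"
    have "(v, (1 - s) * e + s * c) \<in> E"
      using convexD[OF convex d w, of "1 - s" s] s by (simp add: v_def)
    then have "e + ?q d \<le> (1 - s) * e + s * c + ?q v" by (rule min)
    moreover have "(norm (v - y))\<^sup>2
        = (1 - s) * (norm (d - y))\<^sup>2 + s * (norm (w - y))\<^sup>2 - s * (1 - s) * (norm (w - d))\<^sup>2"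
      unfolding v_def power2_norm_eq_inner by (simp add: algebra_simps inner_commute)
    then have "?q v = (1 - s) * ?q d + s * ?q w - s * (1 - s) * (l / 2 * (norm (w - d))\<^sup>2)"
      by (simp only:) (simp add: field_simps)
    \<comment> \<open>The letters keep the quadratic terms atomic, so the rearrangement is purely
      linear in them.\<close>
    moreover have "s * (e + A + (1 - s) * B) \<le> s * (c + C)"
      if "e + A \<le> (1 - s) * e + s * c + V" "V = (1 - s) * A + s * C - s * (1 - s) * B" for A B C V
      using that by (simp add: algebra_simps)
    ultimately have "s * (e + ?q d + (1 - s) * (l / 2 * (norm (w - d))\<^sup>2)) \<le> s * (c + ?q w)"
      by blast
    then show ?thesis using s by simp
  qed
  have "((\<lambda>s. e + ?q d + (1 - s) * (l / 2 * (norm (w - d))\<^sup>2)) \<longlongrightarrow>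
      e + ?q d + (1 - 0) * (l / 2 * (norm (w - d))\<^sup>2)) (at_right 0)"
    by (intro tendsto_intros)
  moreover have "\<forall>\<^sub>F s in at_right 0. e + ?q d + (1 - s) * (l / 2 * (norm (w - d))\<^sup>2) \<le> c + ?q w"
    unfolding eventually_at_right_field by (rule exI[of _ 1]) (use ineq in auto)
  ultimately have "e + ?q d + (1 - 0) * (l / 2 * (norm (w - d))\<^sup>2) \<le> c + ?q w"
    by (rule tendsto_upperbound) simp
  then show ?thesis by simp
qed

section \<open>The subproblem\<close>

lemma objective_finite:
  assumes "\<And>i. closed_proper_convex (g i)" and "w \<in> effective_domain (objective f g)"
  shows "g i w = ereal (real_of_ereal (g i w))"
    and "objective f g w i = ereal (f i w + real_of_ereal (g i w))"
    and "objective f g w i = ereal (real_of_ereal (objective f g w i))"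
proof -
  have "g i w \<noteq> -\<infinity>" using assms(1) by (simp add: closed_proper_convex_def)
  moreover have "g i w \<noteq> \<infinity>" using assms(2) by (auto simp: effective_domain_def objective_def)
  ultimately show g: "g i w = ereal (real_of_ereal (g i w))" by (cases "g i w") auto
  then show "objective f g w i = ereal (f i w + real_of_ereal (g i w))"
    by (metis objective_def plus_ereal.simps(1))
  then show "objective f g w i = ereal (real_of_ereal (objective f g w i))" by simp
qed

lemma less_PInfty_if_le_ereal: "a \<le> ereal b \<Longrightarrow> a < \<infinity>"
  by (cases a) auto

lemma effective_domain_objective:
  "w \<in> effective_domain (objective f g) \<longleftrightarrow> (\<forall>i. g i w < \<infinity>)"
  by (simp add: effective_domain_def objective_def)

lemma closed_proper_convex_combination:
  assumes cpc: "closed_proper_convex g" and "g a \<le> ereal \<alpha>" "g b \<le> ereal \<beta>"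
    and "0 \<le> s" "0 \<le> t" "s + t = 1"
  shows "g (s *\<^sub>R a + t *\<^sub>R b) \<le> ereal (s * \<alpha> + t * \<beta>)"
proof -
  have "convex (epigraph_ereal g)" using cpc by (simp add: closed_proper_convex_def)
  from convexD[OF this, of "(a, \<alpha>)" "(b, \<beta>)" s t] assms show ?thesis
    by (simp add: epigraph_ereal_def)
qed

lemma convex_effective_domain:
  assumes cpc: "\<And>i. closed_proper_convex (g i)"
  shows "convex (effective_domain (objective f g))"
proof (rule convexI)
  fix a b s t
  assume *: "a \<in> effective_domain (objective f g)" "b \<in> effective_domain (objective f g)"
    "0 \<le> (s::real)" "0 \<le> t" "s + t = 1"
  have "g i (s *\<^sub>R a + t *\<^sub>R b) \<le> ereal (s * real_of_ereal (g i a) + t * real_of_ereal (g i b))" for i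
    using * cpc objective_finite(1)[where g = g and f = f and i = i, OF cpc]
    by (intro closed_proper_convex_combination) auto
  then show "s *\<^sub>R a + t *\<^sub>R b \<in> effective_domain (objective f g)"
    unfolding effective_domain_objective by (blast intro: less_PInfty_if_le_ereal)
qed

lemma convex_on_objective:
  fixes g :: "'m \<Rightarrow> 'a::real_normed_vector \<Rightarrow> ereal"
  assumes cpc: "\<And>i. closed_proper_convex (g i)" and f: "convex_on UNIV (f i)"
  shows "convex_on (effective_domain (objective f g)) (\<lambda>w. real_of_ereal (objective f g w i))"
proof (rule convex_onI)
  fix t :: real and a b :: 'a
  let ?D = "effective_domain (objective f g)"
  let ?w = "(1 - t) *\<^sub>R a + t *\<^sub>R b"
  assume t: "0 < t" "t < 1" and ab: "a \<in> ?D" "b \<in> ?D"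
  then have w: "?w \<in> ?D" using convexD[OF convex_effective_domain[where g = g, OF cpc]] by simp
  have "g i ?w \<le> ereal ((1 - t) * real_of_ereal (g i a) + t * real_of_ereal (g i b))"
    using t ab cpc objective_finite(1)[where g = g and f = f and i = i, OF cpc]
    by (intro closed_proper_convex_combination) auto
  then have "real_of_ereal (g i ?w) \<le> (1 - t) * real_of_ereal (g i a) + t * real_of_ereal (g i b)"
    by (subst (asm) objective_finite(1)[where g = g, OF cpc w]) simp
  moreover have "f i ?w \<le> (1 - t) * f i a + t * f i b" using convex_onD[OF f] t by simp
  ultimately show "real_of_ereal (objective f g ?w i)
      \<le> (1 - t) * real_of_ereal (objective f g a i) + t * real_of_ereal (objective f g b i)"
    unfolding objective_finite(2)[where g = g, OF cpc w] objective_finite(2)[where g = g, OF cpc ab(1)]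
      objective_finite(2)[where g = g, OF cpc ab(2)] real_of_ereal.simps distrib_left by linarith
qed (rule convex_effective_domain[where g = g, OF cpc])

text \<open>Finiteness of the objective at \<open>x\<close> allows every real term to be moved
  across the inequality. The sublevel condition on a maximum thus becomes one epigraph condition for
  each \<open>g i\<close>.\<close>

lemma subproblem_objective_le_iff:
  assumes cpc: "\<And>i. closed_proper_convex (g i)" and x: "x \<in> effective_domain (objective f g)"
  shows "subproblem_objective f gradf g l x y v \<le> ereal b \<longleftrightarrow>
    (\<forall>i. g i v \<le> ereal (b - l / 2 * (norm (v - y))\<^sup>2 - gradf i y \<bullet> (v - y)
      - (f i y - real_of_ereal (objective f g x i))))"
proof -
  define A where "A i = ereal (gradf i y \<bullet> (v - y)) + g i v + ereal (f i y) - objective f g x i" for i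
  have A: "A i \<le> ereal c \<longleftrightarrow> g i v \<le> ereal (c - gradf i y \<bullet> (v - y)
      - (f i y - real_of_ereal (objective f g x i)))" for i c
    unfolding A_def by (subst objective_finite(3)[where g = g, OF cpc x]) (cases "g i v"; auto)
  have "subproblem_objective f gradf g l x y v \<le> ereal b \<longleftrightarrow>
      (MAX i. A i) \<le> ereal (b - l / 2 * (norm (v - y))\<^sup>2)"
    unfolding subproblem_objective_def A_def[symmetric] by (cases "MAX i. A i") auto
  also have "\<dots> \<longleftrightarrow> (\<forall>i. A i \<le> ereal (b - l / 2 * (norm (v - y))\<^sup>2))"
    by (subst Max_le_iff) auto
  finally show ?thesis unfolding A .
qed

text \<open>Three inequalities are chained: convexity of \<open>f i\<close> bounds the linearized
  model at \<open>w\<close> by \<open>c\<close>, strong minimality passes from \<open>w\<close> to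
  \<open>d\<close>, and the descent lemma bounds the true values at \<open>d\<close> by the model
  plus its quadratic term.\<close>

lemma subproblem_solution_descent:
  fixes f :: "'m::finite \<Rightarrow> 'a::euclidean_space \<Rightarrow> real" and y :: 'a
  assumes f_convex: "\<And>i. convex_on UNIV (f i)"
    and f_gradient: "\<And>i w. GDERIV (f i) w :> gradf i w"
    and lipschitz: "\<And>i. l-lipschitz_on UNIV (gradf i)"
    and l: "l > 0"
    and cpc: "\<And>i. closed_proper_convex (g i)"
    and x: "x \<in> effective_domain (objective f g)"
  defines "\<Phi> \<equiv> \<lambda>w i. real_of_ereal (objective f g w i)"
    and "d \<equiv> subproblem_solution f gradf g l x y"
  shows "d \<in> effective_domain (objective f g)"
    and "\<lbrakk>w \<in> effective_domain (objective f g); \<And>i. \<Phi> w i - \<Phi> x i \<le> c\<rbrakk> \<Longrightarrow>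
      \<Phi> d i - \<Phi> x i \<le> c + l / 2 * (norm (w - y))\<^sup>2 - l / 2 * (norm (w - d))\<^sup>2"
proof -
  define p where "p i v = gradf i y \<bullet> (v - y) + (f i y - \<Phi> x i)" for i v
  \<comment> \<open>The epigraph of the maximum in the subproblem, without the quadratic term: an
    intersection of shifted epigraphs, hence closed and convex.\<close>
  define E where "E = {(v, c). \<forall>i. g i v \<le> ereal (c - p i v)}"
  let ?q = "\<lambda>v. l / 2 * (norm (v - y))\<^sup>2"
  let ?\<phi> = "subproblem_objective f gradf g l x y"
  have real_g: "g i v \<le> ereal a \<longleftrightarrow> real_of_ereal (g i v) \<le> a"
    if "v \<in> effective_domain (objective f g)" for i v a
    using objective_finite(1)[where g = g, OF cpc that, of i] by (metis ereal_less_eq(3))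
  have \<phi>_le_iff: "?\<phi> v \<le> ereal b \<longleftrightarrow> (v, b - ?q v) \<in> E" for v b
    unfolding subproblem_objective_le_iff[where g = g, OF cpc x] by (simp add: E_def p_def \<Phi>_def algebra_simps)
  have "E = (\<Inter>i. (\<lambda>u. (fst u, snd u - p i (fst u))) -` epigraph_ereal (g i))"
    by (auto simp: E_def epigraph_ereal_def)
  moreover have "closed ((\<lambda>u. (fst u, snd u - p i (fst u))) -` epigraph_ereal (g i))" for i
    using cpc unfolding closed_proper_convex_def p_def
    by (intro closed_vimage continuous_intros) auto
  ultimately have closed_E: "closed E" by auto
  have convex_E: "convex E"
  proof (rule convexI)
    fix u v :: "'a \<times> real" and s t :: real
    assume u: "u \<in> E" and v: "v \<in> E" and st: "0 \<le> s" "0 \<le> t" "s + t = 1"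
    have t: "t = 1 - s" using st by simp
    have "g i (s *\<^sub>R fst u + t *\<^sub>R fst v)
        \<le> ereal (s * (snd u - p i (fst u)) + t * (snd v - p i (fst v)))" for i
      using u v st cpc by (intro closed_proper_convex_combination) (auto simp: E_def)
    moreover have "s * (snd u - p i (fst u)) + t * (snd v - p i (fst v))
        = s * snd u + t * snd v - p i (s *\<^sub>R fst u + t *\<^sub>R fst v)" for i
      unfolding p_def t by (simp add: algebra_simps)
    ultimately show "s *\<^sub>R u + t *\<^sub>R v \<in> E" by (simp add: E_def case_prod_unfold)
  qed
  define h where "h i = real_of_ereal (g i x) + p i x" for i
  have h_E: "(x, a) \<in> E \<longleftrightarrow> (\<forall>i. h i \<le> a)" for a
    by (simp add: E_def h_def real_g[OF x] le_diff_eq)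
  \<comment> \<open>The vertical line over \<open>x\<close> meets both \<open>E\<close> and its
    complement, as \<open>prox_exists\<close> requires; \<open>undefined\<close> merely names some
    index.\<close>
  have "(x, Max (range h)) \<in> E" by (simp add: h_E)
  moreover have "(x, h undefined - 1) \<notin> E" by (auto simp: h_E intro!: exI[of _ undefined])
  moreover have "h undefined \<le> Max (range h)" by (rule Max_ge) auto
  then have "h undefined - 1 < Max (range h)" by linarith
  ultimately obtain d' e' where d': "(d', e') \<in> E"
    and d'_min: "\<And>v c. (v, c) \<in> E \<Longrightarrow> e' + ?q d' \<le> c + ?q v"
    using prox_exists[OF closed_E convex_E l] by metis
  have "?\<phi> d' \<le> ereal (e' + ?q d')" using d' by (simp add: \<phi>_le_iff)
  moreover have "ereal (e' + ?q d') \<le> ?\<phi> w" for w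
  proof (rule ereal_le_real)
    fix b
    assume "?\<phi> w \<le> ereal b"
    then have "(w, b - ?q w) \<in> E" by (simp only: \<phi>_le_iff)
    from d'_min[OF this] show "ereal (e' + ?q d') \<le> ereal b" by simp
  qed
  \<comment> \<open>\<open>ARG_MIN\<close> selects by choice, so exhibiting the minimizer
    \<open>d'\<close> suffices to make \<open>d\<close> a minimizer.\<close>
  ultimately have "is_arg_min ?\<phi> (\<lambda>_. True) d'"
    unfolding is_arg_min_linorder by (blast intro: order_trans)
  then have "is_arg_min ?\<phi> (\<lambda>_. True) d"
    unfolding d_def subproblem_solution_def arg_min_def by (rule someI)
  then have "?\<phi> d \<le> ?\<phi> d'" by (simp add: is_arg_min_linorder)
  with \<open>?\<phi> d' \<le> ereal (e' + ?q d')\<close> have "?\<phi> d \<le> ereal (e' + ?q d')" by (rule order_trans[rotated])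
  \<comment> \<open>The height over \<open>d\<close> at which the total value, quadratic term
    included, equals the minimum attained at \<open>(d', e')\<close>.\<close>
  moreover define e where "e = e' + ?q d' - ?q d"
  ultimately have d: "(d, e) \<in> E" by (simp add: \<phi>_le_iff)
  then show d_dom: "d \<in> effective_domain (objective f g)"
    unfolding effective_domain_objective E_def by (blast intro: less_PInfty_if_le_ereal)
  show "\<Phi> d i - \<Phi> x i \<le> c + ?q w - l / 2 * (norm (w - d))\<^sup>2"
    if w: "w \<in> effective_domain (objective f g)" and c: "\<And>i. \<Phi> w i - \<Phi> x i \<le> c"
  proof -
    have "real_of_ereal (g i w) \<le> c - p i w" for i
      using c[of i] convex_on_above_gradient[OF f_convex f_gradient, of i y w]
      by (simp add: p_def \<Phi>_def objective_finite(2)[where g = g, OF cpc w])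
    then have "(w, c) \<in> E" by (simp add: E_def real_g[OF w])
    from prox_strong_minimality[OF convex_E d this, of l y] d'_min
    have "e + ?q d + l / 2 * (norm (w - d))\<^sup>2 \<le> c + ?q w" by (simp add: e_def)
    moreover have "real_of_ereal (g i d) \<le> e - p i d"
      using d by (simp add: E_def real_g[OF d_dom])
    then have "\<Phi> d i - \<Phi> x i \<le> e + ?q d"
      using descent_lemma[OF lipschitz f_gradient, of i d y]
      by (simp add: p_def \<Phi>_def objective_finite(2)[where g = g, OF cpc d_dom])
    ultimately show ?thesis by simp
  qed
qed

section \<open>Acceleration\<close>

text \<open>The iteration in real-valued form, limited to its first \<open>n\<close> passes. The
  subproblem facts are conditional on \<open>x k \<in> D\<close>, which is then established by
  induction along the run.\<close>

locale monotone_fista =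
  fixes \<Phi> :: "'a::real_inner \<Rightarrow> 'm::finite \<Rightarrow> real" and D :: "'a set"
    and l :: real and n :: nat and x y z :: "nat \<Rightarrow> 'a" and t :: "nat \<Rightarrow> real"
  assumes l: "l > 0"
    and \<Phi>_convex: "\<And>i. convex_on D (\<lambda>w. \<Phi> w i)"
    and x0: "x 0 \<in> D" and y1: "y 1 = x 0" and t1: "t 1 = 1"
    and z_dom: "\<And>k. k < n \<Longrightarrow> x k \<in> D \<Longrightarrow> z (Suc k) \<in> D"
    and z_descent: "\<And>k w c i. k < n \<Longrightarrow> x k \<in> D \<Longrightarrow> w \<in> D \<Longrightarrow> (\<And>j. \<Phi> w j - \<Phi> (x k) j \<le> c) \<Longrightarrow>
      \<Phi> (z (Suc k)) i - \<Phi> (x k) i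
        \<le> c + l / 2 * (norm (w - y (Suc k)))\<^sup>2 - l / 2 * (norm (w - z (Suc k)))\<^sup>2"
    and x_step: "\<And>k. k < n \<Longrightarrow> x k \<in> D \<Longrightarrow>
      x (Suc k) = (if \<exists>i. \<Phi> (z (Suc k)) i \<le> \<Phi> (x k) i then z (Suc k) else x k)"
    and t_step: "\<And>k. k < n \<Longrightarrow> t (k + 2) = (1 + sqrt (1 + 4 * (t (Suc k))\<^sup>2)) / 2"
    and y_step: "\<And>k. k < n \<Longrightarrow> y (k + 2) = x (Suc k)
      + (t (Suc k) / t (k + 2)) *\<^sub>R (z (Suc k) - x (Suc k))
      + ((t (Suc k) - 1) / t (k + 2)) *\<^sub>R (x (Suc k) - x k)"
begin

lemma x_dom: "k \<le> n \<Longrightarrow> x k \<in> D"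
proof (induction k)
  case (Suc k)
  then show ?case using x_step[of k] z_dom[of k] by auto
qed (rule x0)

text \<open>The new parameter is a root of this quadratic. The weight \<open>t\<^sup>2 - t\<close>
  of the old gap in one pass is therefore the weight \<open>t\<^sup>2\<close> of the new gap in the
  preceding pass.\<close>

lemma t_square: "k < n \<Longrightarrow> (t (k + 2))\<^sup>2 - t (k + 2) = (t (Suc k))\<^sup>2"
proof -
  assume k: "k < n"
  define r where "r = sqrt (1 + 4 * (t (Suc k))\<^sup>2)"
  have "r\<^sup>2 = 1 + 4 * (t (Suc k))\<^sup>2" by (simp add: r_def)
  then show ?thesis unfolding t_step[OF k] r_def[symmetric]
    by (simp add: field_simps power2_eq_square)
qed

text \<open>Each update adds at least 1/2, because the square root is at least twice the old
  parameter.\<close>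

lemma t_lower: "k \<le> n \<Longrightarrow> (real k + 2) / 2 \<le> t (Suc k)"
proof (induction k)
  case (Suc k)
  then have IH: "(real k + 2) / 2 \<le> t (Suc k)" by simp
  then have "2 * t (Suc k) \<le> sqrt (1 + 4 * (t (Suc k))\<^sup>2)"
    by (intro real_le_rsqrt) (simp add: power2_eq_square)
  then show ?case using IH Suc.prems t_step[of k] by simp
qed (use t1 in simp)

lemma t_ge_1: "k \<le> n \<Longrightarrow> 1 \<le> t (Suc k)"
  using t_lower[of k] by simp

text \<open>The update rule accepts \<open>z\<close> as soon as one component does not increase, so the values need
  not decrease monotonically; only the sum with the squared step length is controlled.\<close>

lemma step_le:
  assumes "k < n" "w \<in> D" "\<And>j. \<Phi> w j - \<Phi> (x k) j \<le> c"
  shows "\<Phi> (x (Suc k)) i - \<Phi> (x k) i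
    \<le> c + l / 2 * (norm (w - y (Suc k)))\<^sup>2 - l / 2 * (norm (w - z (Suc k)))\<^sup>2"
  using z_descent[OF assms(1) x_dom assms(2,3), of i] x_step[of k] x_dom[of k] assms(1)
  by (cases "\<exists>i. \<Phi> (z (Suc k)) i \<le> \<Phi> (x k) i")
    (auto simp: not_le dest!: spec[of _ i])

text \<open>The difference on the left is a multiple of \<open>x k - z (Suc k)\<close>, with factor
  \<open>(t (Suc k) - 1) / t (k + 2)\<close> after acceptance and
  \<open>t (Suc k) / t (k + 2)\<close> after rejection. Both lie in [0, 1] since \<open>t\<close>
  does not decrease.\<close>

lemma momentum_le:
  assumes "k < n"
  shows "norm (x (Suc k) - y (k + 2)) \<le> norm (x k - z (Suc k))"
proof -
  have t: "1 \<le> t (Suc k)" "t (Suc k) \<le> t (k + 2)"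
  proof -
    show 1: "1 \<le> t (Suc k)" using t_ge_1[of k] assms by simp
    have 2: "1 \<le> t (k + 2)" using t_ge_1[of "Suc k"] assms by simp
    have "(t (Suc k))\<^sup>2 \<le> (t (k + 2))\<^sup>2" using t_square[OF assms] 2 by simp
    then show "t (Suc k) \<le> t (k + 2)" by (rule power2_le_imp_le) (use 2 in simp)
  qed
  obtain a where a: "0 \<le> a" "a \<le> 1" "x (Suc k) - y (k + 2) = a *\<^sub>R (x k - z (Suc k))"
  proof (cases "x (Suc k) = z (Suc k)")
    case True
    show thesis
      by (rule that[of "(t (Suc k) - 1) / t (k + 2)"])
        (use t in \<open>simp_all add: y_step[OF assms, simplified] True scaleR_diff_right\<close>)
  next
    case False
    then have "x (Suc k) = x k" using x_step[OF assms x_dom] assms by (auto split: if_splits)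
    then show thesis
      by (intro that[of "t (Suc k) / t (k + 2)"])
        (use t in \<open>simp_all add: y_step[OF assms, simplified] scaleR_diff_right\<close>)
  qed
  then show ?thesis by (simp add: mult_left_le_one_le)
qed

lemma energy_bound:
  "k \<le> n \<Longrightarrow> \<Phi> (x k) i + l / 2 * (norm (x k - y (Suc k)))\<^sup>2 \<le> \<Phi> (x 0) i"
proof (induction k)
  case (Suc k)
  then have k: "k < n" by simp
  have "\<Phi> (x (Suc k)) i + l / 2 * (norm (x k - z (Suc k)))\<^sup>2
      \<le> \<Phi> (x k) i + l / 2 * (norm (x k - y (Suc k)))\<^sup>2"
    \<comment> \<open>The comparison point is \<open>x k\<close> itself, with zero increase in every
      component.\<close>
    using step_le[OF k x_dom, of k 0 i] k by simp
  moreover have "l / 2 * (norm (x (Suc k) - y (k + 2)))\<^sup>2 \<le> l / 2 * (norm (x k - z (Suc k)))\<^sup>2"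
    using momentum_le[OF k] l by (intro mult_left_mono power_mono) auto
  ultimately show ?case using Suc by simp
qed (use y1 in simp)

lemma \<Phi>_le_initial: "k \<le> n \<Longrightarrow> \<Phi> (x k) i \<le> \<Phi> (x 0) i"
proof -
  assume k: "k \<le> n"
  have "0 \<le> l / 2 * (norm (x k - y (Suc k)))\<^sup>2" using l by simp
  then show ?thesis using energy_bound[OF k, of i] by linarith
qed

text \<open>This is what the two momentum terms are designed for: the vector left by one pass in the
  Lyapunov function is the one with which the next pass starts, whether or not
  \<open>z (Suc k)\<close> was accepted.\<close>

lemma y_identity:
  assumes "k < n"
  shows "t (k + 2) *\<^sub>R y (k + 2) - (t (k + 2) - 1) *\<^sub>R x (Suc k)
    = t (Suc k) *\<^sub>R z (Suc k) - (t (Suc k) - 1) *\<^sub>R x k"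
proof -
  have "t (k + 2) > 0" using t_ge_1[of "Suc k"] assms by simp
  then have "t (k + 2) *\<^sub>R y (k + 2) = t (k + 2) *\<^sub>R x (Suc k)
      + t (Suc k) *\<^sub>R (z (Suc k) - x (Suc k)) + (t (Suc k) - 1) *\<^sub>R (x (Suc k) - x k)"
    unfolding y_step[OF assms] by (simp add: scaleR_add_right)
  then show ?thesis by (simp add: algebra_simps)
qed

text \<open>At \<open>w' = (1 - 1/t) x + w/t\<close> the gap \<open>s'\<close> of \<open>x\<close> over \<open>w\<close> shrinks at most by the factor
  \<open>1/t\<close>, which yields the contraction \<open>1 - 1/t\<close> of the gap.\<close>

lemma gap_step:
  assumes k: "k < n" and w: "w \<in> D" and s: "\<And>i. s \<le> \<Phi> (x (Suc k)) i - \<Phi> w i"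
    and s': "\<And>i. s' \<le> \<Phi> (x k) i - \<Phi> w i" and j: "s' = \<Phi> (x k) j - \<Phi> w j"
  defines "\<tau> \<equiv> t (Suc k)"
  shows "\<tau>\<^sup>2 * s + l / 2 * (norm (\<tau> *\<^sub>R z (Suc k) - (\<tau> - 1) *\<^sub>R x k - w))\<^sup>2
    \<le> (\<tau>\<^sup>2 - \<tau>) * s' + l / 2 * (norm (\<tau> *\<^sub>R y (Suc k) - (\<tau> - 1) *\<^sub>R x k - w))\<^sup>2"
proof -
  have \<tau>: "\<tau> \<ge> 1" using t_ge_1[of k] k by (simp add: \<tau>_def)
  have xk: "x k \<in> D" using x_dom k by simp
  define w' where "w' = (1 - 1 / \<tau>) *\<^sub>R x k + (1 / \<tau>) *\<^sub>R w"
  have w': "w' \<in> D"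
    using convexD[OF convex_on_imp_convex[OF \<Phi>_convex] xk w, of "1 - 1 / \<tau>" "1 / \<tau>"] \<tau> by (simp add: w'_def)
  \<comment> \<open>Multiplication by \<open>\<tau>\<close> turns distances from \<open>w'\<close>
    into the norms of the Lyapunov function.\<close>
  have scale: "\<tau> * norm (w' - v) = norm (\<tau> *\<^sub>R v - (\<tau> - 1) *\<^sub>R x k - w)" for v
  proof -
    have "\<tau> *\<^sub>R w' = (\<tau> - 1) *\<^sub>R x k + w" using \<tau> by (simp add: w'_def scaleR_add_right right_diff_distrib)
    then have "\<tau> *\<^sub>R (w' - v) = - (\<tau> *\<^sub>R v - (\<tau> - 1) *\<^sub>R x k - w)" by (simp add: scaleR_diff_right)
    then have "norm (\<tau> *\<^sub>R (w' - v)) = norm (\<tau> *\<^sub>R v - (\<tau> - 1) *\<^sub>R x k - w)" by (metis norm_minus_cancel)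
    then show ?thesis using \<tau> by simp
  qed
  have "\<Phi> w' i - \<Phi> (x k) i \<le> - (s' / \<tau>)" for i
  proof -
    have "\<Phi> w' i \<le> (1 - 1 / \<tau>) * \<Phi> (x k) i + (1 / \<tau>) * \<Phi> w i"
      using convex_onD[OF \<Phi>_convex _ _ xk w, of "1 / \<tau>" i] \<tau> by (simp add: w'_def)
    also have "\<dots> = \<Phi> (x k) i - (\<Phi> (x k) i - \<Phi> w i) / \<tau>" by (simp add: diff_divide_distrib algebra_simps)
    also have "\<dots> \<le> \<Phi> (x k) i - s' / \<tau>" using s'[of i] \<tau> by (simp add: divide_right_mono)
    finally show ?thesis by simp
  qed
  \<comment> \<open>Component \<open>j\<close> attains the old gap \<open>s'\<close>, so the change
    in this one component links \<open>s\<close> to \<open>s'\<close>.\<close>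
  from step_le[OF k w' this, of j] s[of j] j
  have "s \<le> s' - s' / \<tau>
      + (l / 2 * (norm (w' - y (Suc k)))\<^sup>2 - l / 2 * (norm (w' - z (Suc k)))\<^sup>2)" by linarith
  then have "\<tau>\<^sup>2 * s \<le> \<tau>\<^sup>2 * (s' - s' / \<tau>
      + (l / 2 * (norm (w' - y (Suc k)))\<^sup>2 - l / 2 * (norm (w' - z (Suc k)))\<^sup>2))"
    by (rule mult_left_mono) simp
  also have "\<dots> = (\<tau>\<^sup>2 - \<tau>) * s' + l / 2 * (\<tau> * norm (w' - y (Suc k)))\<^sup>2
      - l / 2 * (\<tau> * norm (w' - z (Suc k)))\<^sup>2"
    using \<tau> by (simp add: field_simps power2_eq_square)
  finally show ?thesis unfolding scale by simp
qed

text \<open>Induction over the passes. Since \<open>t 1 = 1\<close>, the gap at the start has weight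
  0 and only the initial distance remains on the right.\<close>

lemma lyapunov_bound:
  assumes "k \<le> n" "w \<in> D" "\<And>i. s \<le> \<Phi> (x k) i - \<Phi> w i"
  shows "((t (Suc k))\<^sup>2 - t (Suc k)) * s
      + l / 2 * (norm (t (Suc k) *\<^sub>R y (Suc k) - (t (Suc k) - 1) *\<^sub>R x k - w))\<^sup>2
    \<le> l / 2 * (norm (x 0 - w))\<^sup>2"
  using assms(1,3)
proof (induction k arbitrary: s)
  case 0
  then show ?case using t1 y1 by simp
next
  case (Suc k)
  then have k: "k < n" by simp
  \<comment> \<open>\<open>gap_step\<close> needs a lower bound attained by some component, so the
    induction hypothesis is used with the minimal gap.\<close>
  define j where "j = arg_min_on (\<lambda>i. \<Phi> (x k) i - \<Phi> w i) UNIV"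
  define s' where "s' = \<Phi> (x k) j - \<Phi> w j"
  have s': "s' \<le> \<Phi> (x k) i - \<Phi> w i" for i
    unfolding s'_def j_def by (rule arg_min_least) auto
  have "(t (Suc k))\<^sup>2 * s
      + l / 2 * (norm (t (Suc k) *\<^sub>R z (Suc k) - (t (Suc k) - 1) *\<^sub>R x k - w))\<^sup>2
    \<le> l / 2 * (norm (x 0 - w))\<^sup>2"
    using gap_step[OF k assms(2) Suc.prems(2) s' s'_def] Suc.IH[OF _ s'] k by simp
  then show ?case using t_square[OF k] y_identity[OF k] by simp
qed

lemma gap_bound:
  assumes n: "n \<ge> 1" and w: "w \<in> D" and s: "\<And>i. s \<le> \<Phi> (x n) i - \<Phi> w i" and "s \<ge> 0"
  shows "(real n + 1)\<^sup>2 * s \<le> 2 * l * (norm (w - x 0))\<^sup>2"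
proof -
  obtain k where k: "n = Suc k" using n by (cases n) auto
  have "((real n + 1) / 2)\<^sup>2 \<le> (t n)\<^sup>2" using t_lower[of k] k by (intro power_mono) auto
  then have "((real n + 1) / 2)\<^sup>2 * s \<le> (t n)\<^sup>2 * s" using \<open>s \<ge> 0\<close> by (rule mult_right_mono)
  also have "\<dots> \<le> l / 2 * (norm (x 0 - w))\<^sup>2"
  proof -
    have "0 \<le> l / 2 * (norm (t (Suc n) *\<^sub>R y (Suc n) - (t (Suc n) - 1) *\<^sub>R x n - w))\<^sup>2"
      using l by simp
    \<comment> \<open>By \<open>t_square\<close> the weight after the last pass is
      \<open>(t n)\<^sup>2\<close>; the index shift in \<open>t_lower\<close> gives
      \<open>t n \<ge> (n + 1) / 2\<close>.\<close>
    then show ?thesis using lyapunov_bound[OF order_refl w s] t_square[of k] k by simp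
  qed
  finally show ?thesis by (simp add: power_divide norm_minus_commute mult.commute mult.left_commute)
qed

end

section \<open>The merit function\<close>

text \<open>Suppose some \<open>w\<close> has a gap \<open>s\<close> exceeding \<open>C * R\<close>.
  Every point \<open>v\<close> of the fibre over a dominating Pareto value inherits this gap, so
  \<open>s / C\<close> is a lower bound for all squared distances in the fibre. It then bounds their
  infimum and hence \<open>R\<close>, a contradiction; attainment of the infimum never
  enters.\<close>

lemma merit_le_radius:
  fixes f :: "'m::finite \<Rightarrow> 'a::real_normed_vector \<Rightarrow> real" and g :: "'m \<Rightarrow> 'a \<Rightarrow> ereal"
  defines "\<Phi> \<equiv> \<lambda>w i. real_of_ereal (objective f g w i)"
  assumes cpc: "\<And>i. closed_proper_convex (g i)"
    and x0: "x0 \<in> effective_domain (objective f g)" and x: "x \<in> effective_domain (objective f g)"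
    and le: "\<And>i. \<Phi> x i \<le> \<Phi> x0 i"
    and dominated: "\<forall>w \<in> sublevel (objective f g) (objective f g x0).
      \<exists>xs \<in> weakly_pareto (objective f g). objective f g xs \<le> objective f g w"
    and finite: "radius (objective f g) x0 < \<infinity>"
    and C: "C > 0"
    and gap: "\<And>w s. w \<in> effective_domain (objective f g) \<Longrightarrow> (\<And>i. s \<le> \<Phi> x i - \<Phi> w i) \<Longrightarrow> 0 \<le> s \<Longrightarrow>
      s \<le> C * (norm (w - x0))\<^sup>2"
  shows "merit (objective f g) x \<le> ereal C * radius (objective f g) x0"
proof -
  let ?F = "objective f g"
  have fin: "?F w i = ereal (\<Phi> w i)" if "w \<in> effective_domain ?F" for w i
    unfolding \<Phi>_def by (rule objective_finite(3)[where g = g, OF cpc that])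
  have dist_le_radius: "(INF w \<in> ?F -` {?F xs}. ereal ((norm (w - x0))\<^sup>2)) \<le> radius ?F x0"
    if "xs \<in> weakly_pareto ?F" "?F xs \<le> ?F x0" for xs
    unfolding radius_def by (rule SUP_upper) (use that in \<open>auto simp: sublevel_def\<close>)
  obtain xs0 where "xs0 \<in> weakly_pareto ?F" "?F xs0 \<le> ?F x0"
    using dominated by (auto simp: sublevel_def)
  \<comment> \<open>The supremum ranges over a nonempty family of nonnegative values; this excludes
    minus infinity, the value of an empty supremum.\<close>
  then have "0 \<le> radius ?F x0"
    by (intro order_trans[OF INF_greatest dist_le_radius]) auto
  then obtain R where R: "radius ?F x0 = ereal R" "0 \<le> R"
    using finite by (cases "radius ?F x0") auto
  have "(MIN i. ?F x i - ?F w i) \<le> ereal (C * R)" for w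
  proof (rule ccontr)
    assume "\<not> (MIN i. ?F x i - ?F w i) \<le> ereal (C * R)"
    then have "ereal (C * R) < (MIN i. ?F x i - ?F w i)" by (rule not_le_imp_less)
    then have *: "ereal (C * R) < ?F x i - ?F w i" for i
      by (rule less_le_trans) (rule Min_le, auto)
    have w: "w \<in> effective_domain ?F"
      unfolding effective_domain_def
    proof safe
      fix i
      \<comment> \<open>An infinite value at \<open>w\<close> would make the difference minus
        infinity, contrary to its strict lower bound.\<close>
      show "?F w i < \<infinity>" using *[of i] by (cases "?F w i") (auto simp: fin[OF x])
    qed
    have gt: "C * R < \<Phi> x i - \<Phi> w i" for i using *[of i] by (simp add: fin[OF x] fin[OF w])
    have CR: "0 \<le> C * R" using C R(2) by simp
    have w_x0: "?F w \<le> ?F x0"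
    proof (rule le_funI)
      fix i
      show "?F w i \<le> ?F x0 i" using gt[of i] CR le[of i] by (simp add: fin[OF w] fin[OF x0])
    qed
    then obtain xs where xs: "xs \<in> weakly_pareto ?F" "?F xs \<le> ?F w"
      using dominated by (auto simp: sublevel_def)
    define s where "s = (MIN i. \<Phi> x i - \<Phi> w i)"
    have s: "s \<le> \<Phi> x i - \<Phi> w i" for i unfolding s_def by (rule Min_le) auto
    have s_gt: "C * R < s" unfolding s_def by (subst Min_gr_iff) (use gt in auto)
    have "ereal (s / C) \<le> (INF v \<in> ?F -` {?F xs}. ereal ((norm (v - x0))\<^sup>2))"
    proof (rule INF_greatest)
      fix v
      assume "v \<in> ?F -` {?F xs}"
      then have v_le: "?F v i \<le> ?F w i" for i using xs(2) by (simp add: le_fun_def)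
      then have v: "v \<in> effective_domain ?F"
        using w unfolding effective_domain_def by (blast intro: le_less_trans)
      have "s \<le> \<Phi> x i - \<Phi> v i" for i using s[of i] v_le[of i] by (simp add: fin[OF v] fin[OF w])
      then have "s \<le> C * (norm (v - x0))\<^sup>2" using s_gt CR by (intro gap[OF v]) auto
      then show "ereal (s / C) \<le> ereal ((norm (v - x0))\<^sup>2)" using C by (simp add: field_simps)
    qed
    also have "\<dots> \<le> ereal R"
      using dist_le_radius[OF xs(1) order_trans[OF xs(2) w_x0]] by (simp add: R)
    finally show False using s_gt C by (simp add: field_simps)
  qed
  then show ?thesis by (simp add: merit_def R SUP_least)
qed

section \<open>The rate for a run of the algorithm\<close>

theorem theorem3p5:
  fixes f :: "'m::finite \<Rightarrow> real ^ 'n \<Rightarrow> real"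
    and gradf :: "'m \<Rightarrow> real ^ 'n \<Rightarrow> real ^ 'n"
    and g :: "'m \<Rightarrow> real ^ 'n \<Rightarrow> ereal"
    and F :: "real ^ 'n \<Rightarrow> 'm \<Rightarrow> ereal"
    and L :: "'m \<Rightarrow> real"
    and l \<epsilon> :: real
    and x0 :: "real ^ 'n"
    and N :: enat
    and x y z :: "nat \<Rightarrow> real ^ 'n"
    and t :: "nat \<Rightarrow> real"
  assumes f_convex: "\<And>i. convex_on UNIV (f i)"
    and f_gradient: "\<And>i w. GDERIV (f i) w :> gradf i w"
    and gradient_continuous: "\<And>i. continuous_on UNIV (gradf i)"
    and gradient_lipschitz: "\<And>i. (L i)-lipschitz_on UNIV (gradf i)"
    and L_pos: "\<And>i. L i > 0"
    and g_cpc: "\<And>i. closed_proper_convex (g i)"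
    and F_eq: "F = objective f g"
    and pareto_nonempty: "weakly_pareto F \<noteq> {}"
    and x0_dom: "x0 \<in> effective_domain F"
    and pareto_dominates:
      "\<forall>w \<in> sublevel F (F x0). \<exists>xs \<in> weakly_pareto F. F xs \<le> F w"
    and radius_finite: "radius F x0 < \<infinity>"
    and l_ge: "l \<ge> (MAX i. L i)"
    and eps_pos: "\<epsilon> > 0"
    and run: "mfista_run f gradf g l \<epsilon> x0 N x y z t"
  shows "\<forall>k\<ge>1. enat k \<le> N \<longrightarrow>
           merit F (x k) \<le> 2 * ereal l * radius F x0 / ereal ((real k + 1)\<^sup>2)"
proof (intro allI impI)
  fix n :: nat
  assume n: "1 \<le> n" "enat n \<le> N"
  let ?D = "effective_domain (objective f g)"
  define \<Phi> where "\<Phi> w i = real_of_ereal (objective f g w i)" for w i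
  have L_le: "L i \<le> l" for i
    by (rule order_trans[OF _ l_ge]) (rule Max_ge, auto)
  have l: "l > 0" using L_pos L_le by (rule less_le_trans)
  have lipschitz: "l-lipschitz_on UNIV (gradf i)" for i
    by (rule lipschitz_on_le[OF gradient_lipschitz L_le])
  have fin: "objective f g w i = ereal (\<Phi> w i)" if "w \<in> ?D" for w i
    unfolding \<Phi>_def by (rule objective_finite(3)[where g = g, OF g_cpc that])
  note descent = subproblem_solution_descent[where f = f and g = g and gradf = gradf,
      OF f_convex f_gradient lipschitz l g_cpc, folded \<Phi>_def]
  have init: "x 0 = x0" "y 1 = x0" "t 1 = 1" using run by (simp_all add: mfista_run_def Let_def)
  have step: "z (Suc k) = subproblem_solution f gradf g l (x k) (y (Suc k))"
      "x (Suc k) = (if (MAX i. objective f g (x k) i - objective f g (z (Suc k)) i) \<ge> 0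
        then z (Suc k) else x k)"
      "t (k + 2) = (1 + sqrt (1 + 4 * (t (Suc k))\<^sup>2)) / 2"
      "y (k + 2) = x (Suc k) + (t (Suc k) / t (k + 2)) *\<^sub>R (z (Suc k) - x (Suc k))
        + ((t (Suc k) - 1) / t (k + 2)) *\<^sub>R (x (Suc k) - x k)" if "k < n" for k
  proof -
    have "1 \<le> Suc k" "enat (Suc k) \<le> N" using that n(2) by (auto intro: order_trans[rotated])
    note * = run[unfolded mfista_run_def Let_def, THEN conjunct2, THEN conjunct2, THEN conjunct2,
        THEN conjunct1, rule_format, OF this]
    show "z (Suc k) = subproblem_solution f gradf g l (x k) (y (Suc k))"
      "x (Suc k) = (if (MAX i. objective f g (x k) i - objective f g (z (Suc k)) i) \<ge> 0
        then z (Suc k) else x k)"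
      "t (k + 2) = (1 + sqrt (1 + 4 * (t (Suc k))\<^sup>2)) / 2"
      "y (k + 2) = x (Suc k) + (t (Suc k) / t (k + 2)) *\<^sub>R (z (Suc k) - x (Suc k))
        + ((t (Suc k) - 1) / t (k + 2)) *\<^sub>R (x (Suc k) - x k)"
      using * by simp_all
  qed
  have z_dom: "z (Suc k) \<in> ?D" if "k < n" "x k \<in> ?D" for k
    unfolding step(1)[OF that(1)] by (rule descent(1)[OF that(2)])
  \<comment> \<open>The index \<open>n\<close> of the iterate to be bounded also serves as the
    number of passes; all of them were executed because \<open>enat n \<le> N\<close>.\<close>
  interpret monotone_fista \<Phi> ?D l n x y z t
  proof
    show "x 0 \<in> ?D" "y 1 = x 0" "t 1 = 1" using init x0_dom by (simp_all add: F_eq)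
    show "convex_on ?D (\<lambda>w. \<Phi> w i)" for i
      unfolding \<Phi>_def using convex_on_objective[where g = g, OF g_cpc f_convex] .
  next
    fix k w c i
    assume "k < n" "x k \<in> ?D" "w \<in> ?D" "\<And>j. \<Phi> w j - \<Phi> (x k) j \<le> c"
    then show "\<Phi> (z (Suc k)) i - \<Phi> (x k) i
        \<le> c + l / 2 * (norm (w - y (Suc k)))\<^sup>2 - l / 2 * (norm (w - z (Suc k)))\<^sup>2"
      unfolding step(1)[OF \<open>k < n\<close>] by (intro descent(2))
  next
    fix k
    assume k: "k < n" "x k \<in> ?D"
    \<comment> \<open>Both points lie in the effective domain, so the extended differences are real,
      and the acceptance test says that some component does not increase.\<close>
    have "(MAX i. objective f g (x k) i - objective f g (z (Suc k)) i) \<ge> 0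
        \<longleftrightarrow> (\<exists>i. \<Phi> (z (Suc k)) i \<le> \<Phi> (x k) i)"
      by (subst Max_ge_iff) (auto simp: fin[OF k(2)] fin[OF z_dom[OF k]])
    then show "x (Suc k) = (if \<exists>i. \<Phi> (z (Suc k)) i \<le> \<Phi> (x k) i then z (Suc k) else x k)"
      by (subst step(2)[OF k(1)]) simp
  qed (fact l z_dom step(3,4))+
  define C where "C = 2 * l / (real n + 1)\<^sup>2"
  have "merit F (x n) \<le> ereal C * radius F x0"
    unfolding F_eq
  proof (rule merit_le_radius, fold \<Phi>_def)
    show "x0 \<in> ?D" "radius (objective f g) x0 < \<infinity>"
      using x0_dom radius_finite by (simp_all add: F_eq)
    show "\<forall>w \<in> sublevel (objective f g) (objective f g x0).
        \<exists>xs \<in> weakly_pareto (objective f g). objective f g xs \<le> objective f g w"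
      using pareto_dominates by (simp add: F_eq)
    show "x n \<in> ?D" by (rule x_dom) simp
    show "\<Phi> (x n) i \<le> \<Phi> x0 i" for i using \<Phi>_le_initial[of n i] init by simp
    show "C > 0" using l by (simp add: C_def)
    show "s \<le> C * (norm (w - x0))\<^sup>2"
      if "w \<in> ?D" "\<And>i. s \<le> \<Phi> (x n) i - \<Phi> w i" "0 \<le> s" for w s
    proof -
      have "(real n + 1)\<^sup>2 * s \<le> 2 * l * (norm (w - x0))\<^sup>2"
        using gap_bound[OF n(1) that] init by simp
      moreover have "(real n + 1)\<^sup>2 > 0" by simp
      ultimately show ?thesis by (simp add: C_def pos_le_divide_eq mult.commute)
    qed
  qed (rule g_cpc)
  also have "\<dots> = 2 * ereal l * radius F x0 / ereal ((real n + 1)\<^sup>2)"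
    by (cases "radius F x0") (use l radius_finite in \<open>auto simp: C_def\<close>)
  finally show "merit F (x n) \<le> 2 * ereal l * radius F x0 / ereal ((real n + 1)\<^sup>2)" .
qed

end
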